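(* (a) For each binary Dyck vector $w$, $[w]\in\mathrm{TAIL}(\mu)$ for exactly one partition $\mu$. (b) For each non-reduced ternary Dyck vector $w$, $[w]\in\mathrm{TAIL}(\mu)$ for exactly one partition $\mu$. (c) For each reduced ternary Dyck vector $w$ containing $2$, $[w]\in\mathrm{TAIL}(\mu)$ for some (necessarily unique) partition $\mu$ if and only if $w_1=0$ is the only $0$ in $w$ before the last $2$ in $w$.
   Context: A quasi-Dyck vector (QDV) is an integer sequence $v=v_1v_2\cdots v_n$ with $v_1=0$ and $v_{i+1}\le v_i+1$ for all $i<n$; a Dyck vector is a QDV with all entries $\ge 0$; a binary (resp. ternary) Dyck vector is a Dyck vector with entries in $\{0,1\}$ (resp. $\{0,1,2\}$). We use word notation; $i^c$ means $c$ copies of $i$; $W^{+}$ adds $1$ to each entry of $W$. Dyck classes $[v]$ are the equivalence classes of the equivalence relation on QDVs generated by $v\sim 0v^+$. An integer partition $\lambda$ (with $\ell(\lambda)$ positive parts and $\lambda_i=0$ for $i>\ell(\lambda)$; the zero partition $\langle 0\rangle$ is allowed) is identified with the Dyck class consisting of all QDVs $\mathrm{QDV}_n(\lambda)=(0-\lambda_n,1-\lambda_{n-1},\ldots,n-1-\lambda_1)$, $n>\ell(\lambda)$; this is a bijection between partitions and Dyck classes. $\mathrm{min}_{\Delta}(\lambda)$ is the least $n>\ell(\lambda)$ such that $\mathrm{QDV}_n(\lambda)$ has all entries nonnegative; for this $n$, $\mathrm{QDV}_n(\lambda)$ is the reduced Dyck vector of $\lambda$ (or of its Dyck class). A Dyck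 vector is reduced if it is the reduced Dyck vector of its class. The map $\mathrm{NU}_1$ is defined on partitions $\gamma$ with $\gamma_1\le \ell(\gamma)+2$ by $\mathrm{NU}_1(\gamma)=\langle \ell+1,\gamma_1-1,\ldots,\gamma_\ell-1\rangle$, $\ell=\ell(\gamma)$ (zero parts dropped); it is viewed as acting on Dyck classes. For nonzero $\mu=\langle r^{n_r}\cdots 2^{n_2}1^{n_1}\rangle$ with $n_r>0$ ($n_i$ is the number of parts equal to $i$), $B_\mu=01^{n_1}01^{n_2}\cdots 01^{n_r}$; $B_{\langle 0\rangle}$ is the empty word. $\mathrm{TI}(\mu)=[0B_\mu]$, and $\mathrm{TAIL}(\mu)$ is the sequence of Dyck classes reachable from $\mathrm{TI}(\mu)$ by applying $\mathrm{NU}_1$ zero or more times. *)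

theory Defs
  imports Main
begin

definition is_qdv :: "int list \<Rightarrow> bool" where
  "is_qdv v \<longleftrightarrow> v \<noteq> [] \<and> v ! 0 = 0 \<and> (\<forall>i. i + 1 < length v \<longrightarrow> v ! (i + 1) \<le> v ! i + 1)"

definition is_dyck :: "int list \<Rightarrow> bool" where
  "is_dyck v \<longleftrightarrow> is_qdv v \<and> (\<forall>x\<in>set v. 0 \<le> x)"

definition is_binary_dyck :: "int list \<Rightarrow> bool" where
  "is_binary_dyck v \<longleftrightarrow> is_dyck v \<and> set v \<subseteq> {0, 1}"

definition is_ternary_dyck :: "int list \<Rightarrow> bool" where
  "is_ternary_dyck v \<longleftrightarrow> is_dyck v \<and> set v \<subseteq> {0, 1, 2}"

definition plus_word :: "int list \<Rightarrow> int list" where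
  "plus_word v = map (\<lambda>x. x + 1) v"

definition dyck_step :: "int list \<Rightarrow> int list \<Rightarrow> bool" where
  "dyck_step v w \<longleftrightarrow> is_qdv v \<and> w = 0 # plus_word v"

definition dyck_rel :: "(int list \<times> int list) set" where
  "dyck_rel = {(v, w). is_qdv v \<and> is_qdv w \<and> equivclp dyck_step v w}"

definition dyck_class :: "int list \<Rightarrow> int list set" where
  "dyck_class v = dyck_rel `` {v}"

text \<open>
  A partition is the weakly decreasing list of its positive parts, so \<open>[]\<close> is the zero
  partition and \<open>length\<close> is the number of positive parts. Parts are indexed from 1 and
  padded with zeros.
\<close>

definition is_partition :: "nat list \<Rightarrow> bool" where
  "is_partition p \<longleftrightarrow> sorted_wrt (\<ge>) p \<and> (\<forall>k\<in>set p. 0 < k)"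

definition part :: "nat list \<Rightarrow> nat \<Rightarrow> nat" where
  "part p i = (if 1 \<le> i \<and> i \<le> length p then p ! (i - 1) else 0)"

definition QDV :: "nat \<Rightarrow> nat list \<Rightarrow> int list" where
  "QDV n p = map (\<lambda>i. int i - int (part p (n - i))) [0..<n]"

definition partition_class :: "nat list \<Rightarrow> int list set" where
  "partition_class p = {QDV n p | n. length p < n}"

definition min_Delta :: "nat list \<Rightarrow> nat" where
  "min_Delta p = (LEAST n. length p < n \<and> (\<forall>x\<in>set (QDV n p). 0 \<le> x))"

definition reduced_dyck_vector :: "nat list \<Rightarrow> int list" where
  "reduced_dyck_vector p = QDV (min_Delta p) p"

definition is_reduced :: "int list \<Rightarrow> bool" where
  "is_reduced w \<longleftrightarrow> is_dyck w \<and>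
     (\<exists>p. is_partition p \<and> partition_class p = dyck_class w \<and> w = reduced_dyck_vector p)"

definition NU1_defined :: "nat list \<Rightarrow> bool" where
  "NU1_defined p \<longleftrightarrow> is_partition p \<and> part p 1 \<le> length p + 2"

definition NU1 :: "nat list \<Rightarrow> nat list" where
  "NU1 p = (length p + 1) # filter (\<lambda>k. 0 < k) (map (\<lambda>k. k - 1) p)"

text \<open>The graph of the partial map \<open>NU1\<close>, transported to Dyck classes.\<close>

definition NU1_class :: "int list set \<Rightarrow> int list set \<Rightarrow> bool" where
  "NU1_class C D \<longleftrightarrow>
     (\<exists>p. NU1_defined p \<and> C = partition_class p \<and> D = partition_class (NU1 p))"

text \<open>
  Here \<open>part p 1\<close> is the largest part (0 for the zero partition), so \<open>B_word []\<close> is empty.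
\<close>

definition B_word :: "nat list \<Rightarrow> int list" where
  "B_word p = concat (map (\<lambda>i. 0 # replicate (count_list p i) 1) [1..<part p 1 + 1])"

definition TI :: "nat list \<Rightarrow> int list set" where
  "TI p = dyck_class (0 # B_word p)"

definition TAIL :: "nat list \<Rightarrow> int list set set" where
  "TAIL p = {C. NU1_class\<^sup>*\<^sup>* (TI p) C}"

text \<open>
  The 0-based position of the last 2. It is meaningful only if \<open>2 \<in> set w\<close>, since \<open>Max {}\<close>
  is unspecified.
\<close>

definition last_two :: "int list \<Rightarrow> nat" where
  "last_two w = Max {j. j < length w \<and> w ! j = 2}"

end

theory Submission
  imports Defs
begin

text \<open>
  On classes, \<open>NU1\<close> sends \<open>[0 1 T]\<close> to \<open>[0 T 0]\<close> when \<open>T\<close> does not begin with 2. Iterating this from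
  \<open>[0 B]\<close>, with \<open>B = B_word p\<close>, and rewriting \<open>[0 R]\<close> as \<open>[0 1 R\<^sup>+]\<close>, one finds that \<open>TAIL p\<close> consists of
  the classes \<open>[0 1 Q\<^sup>+ P]\<close> with \<open>P Q = B 0\<^sup>k\<close> for some \<open>k\<close>. Every binary word that is empty or begins
  with 0 is \<open>B_word p\<close> followed by zeros for a unique partition \<open>p\<close>. A class has at most one Dyck
  representative that has length 1 or contains a second 0, namely the reduced one; in the reduced
  representative \<open>0 1 Q\<^sup>+ P\<close> with nonempty \<open>P\<close>, the second 0 marks the beginning of \<open>P\<close>, so \<open>P\<close> and \<open>Q\<close>
  can be read off.
\<close>

section \<open>The shift of a QDV and the equivalence it generates\<close>

definition shift :: "int list \<Rightarrow> int list" where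
  "shift v = 0 # plus_word v"

lemma dyck_step_iff: "dyck_step v w \<longleftrightarrow> is_qdv v \<and> w = shift v"
  by (simp add: dyck_step_def shift_def)

lemma shift_inject [simp]: "shift v = shift w \<longleftrightarrow> v = w"
  by (simp add: shift_def plus_word_def inj_map_eq_map inj_on_def)

lemma length_shift [simp]: "length (shift v) = Suc (length v)"
  by (simp add: shift_def plus_word_def)

lemma plus_word_simps [simp]:
  "plus_word [] = []"
  "plus_word (x # xs) = (x + 1) # plus_word xs"
  "plus_word (xs @ ys) = plus_word xs @ plus_word ys"
  "length (plus_word xs) = length xs"
  "set (plus_word xs) = (\<lambda>x. x + 1) ` set xs"
  "(plus_word xs = []) = (xs = [])"
  by (simp_all add: plus_word_def)

lemma plus_word_map_diff [simp]: "plus_word (map (\<lambda>x. x - 1) v) = v"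
  by (simp add: plus_word_def comp_def)

text \<open>The words below are built by cons and append, for which \<open>successively\<close>
  decomposes directly; this form therefore replaces the indexed one.\<close>

lemma is_qdv_iff_successively:
  "is_qdv v \<longleftrightarrow> v \<noteq> [] \<and> hd v = 0 \<and> successively (\<lambda>x y. y \<le> x + 1) v"
  by (auto simp: is_qdv_def successively_conv_nth hd_conv_nth)

lemma successively_plus_word [simp]:
  "successively (\<lambda>x y. y \<le> x + 1) (plus_word v) \<longleftrightarrow> successively (\<lambda>x y. y \<le> x + 1) v"
  by (induction v rule: induct_list012) auto

lemma hd_plus_word: "v \<noteq> [] \<Longrightarrow> hd (plus_word v) = hd v + 1"
  by (simp add: plus_word_def hd_map)

text \<open>The first entry of \<open>v\<close> may be negative: after the leading 0 only a rise by
  more than 1 is forbidden. So the shift of a word that is no QDV can be one.\<close>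

lemma is_qdv_shift: "is_qdv (shift v) \<longleftrightarrow> v = [] \<or> hd v \<le> 0 \<and> successively (\<lambda>x y. y \<le> x + 1) v"
  by (cases v) (auto simp: is_qdv_iff_successively successively_Cons shift_def hd_plus_word)

lemma is_qdv_shiftI: "is_qdv v \<Longrightarrow> is_qdv (shift v)"
  by (simp add: is_qdv_shift) (simp add: is_qdv_iff_successively)

lemma funpow_shift_inject: "(shift ^^ n) v = (shift ^^ n) w \<longleftrightarrow> v = w"
  by (induction n) auto

text \<open>A chain of steps in either direction closes up under further shifts: a forward step
  costs one more shift of \<open>v\<close>, a backward step one more shift of the other end.\<close>

lemma equivclp_dyck_step_imp:
  assumes "equivclp dyck_step v w"
  shows "\<exists>m n. (shift ^^ m) v = (shift ^^ n) w"
  using assms unfolding equivclp_def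
proof (induction rule: rtranclp_induct)
  case base
  then show ?case by blast
next
  case (step y z)
  then obtain m n where eq: "(shift ^^ m) v = (shift ^^ n) y" by blast
  from step.hyps(2) consider "z = shift y" | "y = shift z"
    by (auto simp: dyck_step_iff elim: symclpE)
  then show ?case
  proof cases
    case 1
    with eq have "(shift ^^ Suc m) v = (shift ^^ n) z" by (simp add: funpow_swap1)
    then show ?thesis by blast
  next
    case 2
    with eq have "(shift ^^ m) v = (shift ^^ Suc n) z" by (simp add: funpow_swap1)
    then show ?thesis by blast
  qed
qed

lemma equiv_dyck_rel: "equiv (Collect is_qdv) dyck_rel"
  unfolding dyck_rel_def
  by (auto intro!: equivI symI transI refl_onI intro: equivclp_sym equivclp_trans)

lemma dyck_class_eq_iff:
  "is_qdv v \<Longrightarrow> is_qdv w \<Longrightarrow> dyck_class v = dyck_class w \<longleftrightarrow> equivclp dyck_step v w"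
  unfolding dyck_class_def using eq_equiv_class_iff[OF equiv_dyck_rel, of v w]
  by (simp add: dyck_rel_def)

lemma dyck_class_shift: "is_qdv v \<Longrightarrow> dyck_class (shift v) = dyck_class v"
  by (subst dyck_class_eq_iff)
    (auto simp: dyck_step_iff intro!: is_qdv_shiftI intro: equivclp_sym r_into_equivclp)

text \<open>The shift of a Dyck vector has no 0 after its first entry, so this condition singles out at
  most one representative of a class.\<close>

definition unshifted :: "int list \<Rightarrow> bool" where
  "unshifted v \<longleftrightarrow> is_dyck v \<and> (v = [0] \<or> 0 \<in> set (tl v))"

lemma is_dyck_funpow_shift: "is_dyck v \<Longrightarrow> is_dyck ((shift ^^ n) v)"
proof (induction n)
  case (Suc n)
  then show ?case by (auto simp: is_dyck_def shift_def dest: is_qdv_shiftI)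
qed simp

lemma not_unshifted_shift: "is_dyck v \<Longrightarrow> \<not> unshifted (shift v)"
  by (cases v) (auto simp: unshifted_def is_dyck_def is_qdv_def shift_def)

text \<open>Equivalent vectors meet after some shifts, so by injectivity of the shift one is an
  iterated shift of the other. An unshifted vector is not the shift of a Dyck vector, which leaves
  only zero iterations.\<close>

lemma unshifted_unique:
  assumes "unshifted v" "unshifted w" "dyck_class v = dyck_class w"
  shows "v = w"
proof -
  have le: "v = w"
    if *: "(shift ^^ m) v = (shift ^^ n) w" "unshifted v" "unshifted w" "m \<le> n" for v w m n
  proof -
    obtain k where n: "n = m + k" using le_Suc_ex[OF *(4)] by blast
    with *(1) have v: "v = (shift ^^ k) w" by (simp add: funpow_add funpow_shift_inject)
    show ?thesis
    proof (cases k)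
      case (Suc j)
      then have "v = shift ((shift ^^ j) w)" using v by simp
      moreover have "is_dyck w" using *(3) by (simp add: unshifted_def)
      ultimately show ?thesis
        using *(2) not_unshifted_shift is_dyck_funpow_shift by blast
    qed (use v in simp)
  qed
  obtain m n where "(shift ^^ m) v = (shift ^^ n) w"
    using assms equivclp_dyck_step_imp dyck_class_eq_iff[of v w]
    unfolding unshifted_def is_dyck_def by blast
  then show ?thesis
    using le[of m v n w] le[of n w m v] assms by (cases "m \<le> n") auto
qed

text \<open>Without a second 0, all entries after the first are at least 1, so lowering them by 1
  keeps them nonnegative. The new first entry is also at most 0 by the QDV condition, hence equals
  0.\<close>

lemma dyck_shift_cases:
  assumes "is_dyck w" "\<not> unshifted w"
  obtains v where "is_dyck v" "w = shift v"
proof -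
  obtain u where w: "w = 0 # u" "u \<noteq> []" "0 \<notin> set u"
    using assms by (cases w) (auto simp: unshifted_def is_dyck_def is_qdv_def)
  then have pos: "\<forall>x\<in>set u. 1 \<le> x" using assms(1) by (auto simp: is_dyck_def int_one_le_iff_zero_less less_le)
  define v where "v = map (\<lambda>x. x - 1) u"
  have wv: "w = shift v" using w by (simp add: v_def shift_def)
  have "hd u \<in> set u" using w by simp
  with pos have "1 \<le> hd u" by blast
  then have "hd v \<ge> 0" using w by (simp add: v_def hd_map)
  moreover have "v \<noteq> []" using w v_def by simp
  moreover have "hd v \<le> 0 \<and> successively (\<lambda>x y. y \<le> x + 1) v"
    using assms(1) w unfolding wv is_dyck_def is_qdv_shift by (simp add: v_def)
  ultimately have "is_dyck v"
    using pos by (auto simp: is_dyck_def is_qdv_iff_successively v_def)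
  with wv that show thesis by blast
qed

section \<open>Partitions and their QDVs\<close>

lemma length_QDV [simp]: "length (QDV n p) = n"
  by (simp add: QDV_def)

lemma QDV_nth: "i < n \<Longrightarrow> QDV n p ! i = int i - int (part p (n - i))"
  by (simp add: QDV_def)

lemma part_mono:
  assumes "is_partition p" "1 \<le> i" "i \<le> j"
  shows "part p j \<le> part p i"
proof (cases "i = j")
  case False
  then have "p ! (i - 1) \<ge> p ! (j - 1)" if "j \<le> length p"
    using that assms sorted_wrt_nth_less[of "(\<ge>)" p "i - 1" "j - 1"] by (simp add: is_partition_def)
  then show ?thesis using assms by (auto simp: part_def)
qed simp

lemma part_pos_iff: "is_partition p \<Longrightarrow> 0 < part p i \<longleftrightarrow> 1 \<le> i \<and> i \<le> length p"
  by (auto simp: part_def is_partition_def)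

lemma is_qdv_QDV:
  assumes "is_partition p" "length p < n"
  shows "is_qdv (QDV n p)"
  unfolding is_qdv_def
proof (intro conjI allI impI)
  show "QDV n p \<noteq> []" using assms(2) by (metis length_QDV list.size(3) not_less0)
  show "QDV n p ! 0 = 0" using assms(2) by (simp add: QDV_nth part_def)
  fix i assume "i + 1 < length (QDV n p)"
  then show "QDV n p ! (i + 1) \<le> QDV n p ! i + 1"
    using part_mono[OF assms(1), of "n - (i + 1)" "n - i"] by (simp add: QDV_nth)
qed

lemma QDV_Suc:
  assumes "length p < n"
  shows "QDV (Suc n) p = shift (QDV n p)"
proof (rule nth_equalityI)
  fix i assume "i < length (QDV (Suc n) p)"
  then show "QDV (Suc n) p ! i = shift (QDV n p) ! i"
    using assms by (cases i) (auto simp: QDV_nth shift_def plus_word_def part_def)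
qed simp

lemma funpow_shift_QDV: "length p < n \<Longrightarrow> (shift ^^ k) (QDV n p) = QDV (n + k) p"
  by (induction k) (simp_all flip: QDV_Suc)

text \<open>The shift begins with 0 1, and the entry 1 at position 1 says that part number
  \<open>length v\<close> is zero. So \<open>n - 1\<close> still exceeds the number of parts, and
  the shift can be undone within the family of QDVs of \<open>p\<close>.\<close>

lemma shift_eq_QDV:
  assumes p: "is_partition p" and v: "is_qdv v" and eq: "shift v = QDV n p"
  shows "v = QDV (length v) p \<and> length p < length v"
proof -
  have n: "n = Suc (length v)" using arg_cong[OF eq, of length] by simp
  have "v \<noteq> []" "v ! 0 = 0" using v by (auto simp: is_qdv_def)
  then have "shift v ! 1 = 1" by (cases v) (auto simp: shift_def)
  then have "part p (length v) = 0"
    using \<open>v \<noteq> []\<close> by (simp add: eq QDV_nth n)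
  then have "length p < length v"
    using part_pos_iff[OF p, of "length v"] \<open>v \<noteq> []\<close> by (auto simp: Suc_le_eq)
  with eq n show ?thesis by (simp add: QDV_Suc)
qed

lemma funpow_shift_eq_QDV:
  assumes "is_partition p" "is_qdv v" "length p < n" "(shift ^^ k) v = QDV n p"
  shows "v = QDV (length v) p \<and> length p < length v"
  using assms(3,4)
proof (induction k arbitrary: n)
  case 0
  then show ?case by auto
next
  case (Suc k)
  have "is_qdv ((shift ^^ k) v)"
    by (induction k) (use assms(2) is_qdv_shiftI in auto)
  with shift_eq_QDV[OF assms(1)] Suc show ?case by (metis comp_apply funpow.simps(2))
qed

text \<open>The vectors \<open>QDV m p\<close> are shifts of one another. Conversely, a QDV that
  some shifts carry into this family belongs to it, by undoing the shifts one at a time.\<close>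

lemma partition_class_eq:
  assumes p: "is_partition p" and n: "length p < n"
  shows "partition_class p = dyck_class (QDV n p)"
proof (intro equalityI subsetI)
  fix w assume "w \<in> partition_class p"
  then obtain m where m: "w = QDV m p" "length p < m" by (auto simp: partition_class_def)
  have *: "dyck_class (QDV (a + k) p) = dyck_class (QDV a p)" if "length p < a" for a k
    by (induction k) (use that p in \<open>simp_all add: QDV_Suc dyck_class_shift is_qdv_QDV\<close>)
  have "dyck_class (QDV n p) = dyck_class w"
    using *[of n "m - n"] *[of m "n - m"] n m by (cases "n \<le> m") auto
  then show "w \<in> dyck_class (QDV n p)"
    using dyck_class_eq_iff[OF is_qdv_QDV is_qdv_QDV, OF p n p m(2)] m p n
    by (simp add: dyck_class_def dyck_rel_def is_qdv_QDV)
next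
  fix w assume "w \<in> dyck_class (QDV n p)"
  then have w: "is_qdv w" "equivclp dyck_step (QDV n p) w" by (auto simp: dyck_class_def dyck_rel_def)
  then obtain a b where "(shift ^^ a) (QDV n p) = (shift ^^ b) w"
    using equivclp_dyck_step_imp by blast
  then have "(shift ^^ b) w = QDV (n + a) p" using n by (simp add: funpow_shift_QDV)
  then show "w \<in> partition_class p"
    using funpow_shift_eq_QDV[OF p w(1), of "n + a" b] n by (auto simp: partition_class_def)
qed

lemma QDV_inject:
  assumes "is_partition p" "is_partition q" "length p < n" "length q < n" "QDV n p = QDV n q"
  shows "p = q"
proof -
  have part: "part p i = part q i" for i
  proof (cases "1 \<le> i \<and> i \<le> n")
    case True
    then show ?thesis
      using arg_cong[OF assms(5), of "\<lambda>v. v ! (n - i)"] by (simp add: QDV_nth)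
  qed (use assms(3,4) in \<open>auto simp: part_def\<close>)
  have "length p = length q"
    using part_pos_iff[OF assms(1), of "length q"] part_pos_iff[OF assms(2), of "length q"]
      part_pos_iff[OF assms(1), of "length p"] part_pos_iff[OF assms(2), of "length p"]
    by (simp add: part) (metis One_nat_def Suc_leI le_antisym length_0_conv length_greater_0_conv le0)
  moreover have "p ! i = q ! i" if "i < length p" for i
    using part[of "Suc i"] that \<open>length p = length q\<close> by (simp add: part_def)
  ultimately show ?thesis by (simp add: list_eq_iff_nth_eq)
qed

lemma partition_class_inject:
  assumes "is_partition p" "is_partition q" "partition_class p = partition_class q"
  shows "p = q"
proof -
  \<comment> \<open>This exceeds both numbers of parts, so the same \<open>n\<close> serves
    \<open>p\<close> and \<open>q\<close>; the length of a vector then identifies its index in the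
    class.\<close>
  define n where "n = Suc (length p + length q)"
  have "QDV n p \<in> partition_class q"
    using assms(3) unfolding n_def by (force simp: partition_class_def)
  then obtain m where "QDV n p = QDV m q" by (auto simp: partition_class_def)
  then have "QDV n p = QDV n q" by (metis length_QDV)
  then show ?thesis using QDV_inject[OF assms(1,2), of n] by (simp add: n_def)
qed

text \<open>By the QDV condition the differences \<open>int i - v ! i\<close> are nonnegative and
  weakly increasing in \<open>i\<close>. Read from the end, they are the parts followed by padding
  zeros.\<close>

lemma qdv_eq_QDV:
  assumes v: "is_qdv v"
  obtains p where "is_partition p" "length p < length v" "v = QDV (length v) p"
proof -
  define n where "n = length v"
  have n: "0 < n" using v by (auto simp: is_qdv_def n_def)
  have bound: "v ! i \<le> int i" if "i < n" for i
    using that by (induction i) (use v in \<open>force simp: is_qdv_def n_def\<close>)+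
  have mono: "int i - v ! i \<le> int j - v ! j" if "i \<le> j" "j < n" for i j
    using that by (induction rule: dec_induct) (use v in \<open>force simp: is_qdv_def n_def\<close>)+
  define xs where "xs = map (\<lambda>k. nat (int (n - Suc k) - v ! (n - Suc k))) [0..<n]"
  have len: "length xs = n" by (simp add: xs_def)
  have nth: "int (xs ! k) = int (n - Suc k) - v ! (n - Suc k)" if "k < n" for k
    using that bound[of "n - Suc k"] by (simp add: xs_def)
  have desc: "xs ! j \<le> xs ! i" if "i \<le> j" "j < n" for i j
    using mono[of "n - Suc j" "n - Suc i"] nth[of i] nth[of j] that by (simp add: diff_le_mono2)
  define p where "p = takeWhile (\<lambda>k. 0 < k) xs"
  have lp: "length p \<le> n" by (simp add: p_def flip: len) (rule length_takeWhile_le)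
  have pnth: "p ! k = xs ! k" if "k < length p" for k
    using that unfolding p_def by (rule takeWhile_nth)
  \<comment> \<open>The entry \<open>v ! 0 = 0\<close> contributes a 0 at the end of
    \<open>xs\<close>, so at least one padding zero is cut off and
    \<open>length p < n\<close>.\<close>
  have "p \<noteq> xs"
  proof
    assume "p = xs"
    then have "\<forall>x\<in>set xs. 0 < x" by (auto simp: p_def takeWhile_eq_all_conv)
    then have "0 < xs ! (n - 1)" using len n by simp
    then show False using nth[of "n - 1"] n v by (simp add: is_qdv_def)
  qed
  then have lp: "length p < n" using lp len unfolding p_def
    by (metis le_neq_implies_less takeWhile_eq_take take_all_iff order_refl)
  have part: "part p (Suc k) = xs ! k" if "k < n" for k
  proof (cases "k < length p")
    case False
    have "xs ! length p = 0"
      using nth_length_takeWhile[of "\<lambda>k. 0 < k" xs] lp by (simp add: p_def len)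
    then have "xs ! k = 0" using desc[of "length p" k] False that by simp
    then show ?thesis using False by (simp add: part_def)
  qed (simp add: part_def pnth)
  have "is_partition p"
    unfolding is_partition_def
  proof
    show "sorted_wrt (\<ge>) p"
      using lp by (auto simp: sorted_wrt_iff_nth_less pnth intro!: desc)
    show "\<forall>k\<in>set p. 0 < k" by (auto simp: p_def dest: set_takeWhileD)
  qed
  moreover have "v = QDV n p"
  proof (rule nth_equalityI)
    fix i assume "i < length v"
    then have i: "i < n" by (simp add: n_def)
    then show "v ! i = QDV n p ! i"
      using part[of "n - Suc i"] nth[of "n - Suc i"] by (simp add: QDV_nth Suc_diff_Suc)
  qed (simp add: n_def)
  ultimately show thesis using that[of p] lp by (simp add: n_def)
qed

section \<open>Characterisation of reduced Dyck vectors\<close>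

text \<open>If a reduced vector were the shift of a Dyck vector, the latter would be a shorter
  nonnegative QDV of the same partition. Conversely, a shorter nonnegative QDV would exhibit an
  unshifted vector as a proper iterated shift of a Dyck vector.\<close>

lemma is_reduced_iff_unshifted: "is_reduced w \<longleftrightarrow> unshifted w"
proof
  assume r: "is_reduced w"
  then obtain p where p: "is_partition p" "partition_class p = dyck_class w" "w = QDV (min_Delta p) p"
    by (auto simp: is_reduced_def reduced_dyck_vector_def)
  have w: "is_dyck w" using r by (simp add: is_reduced_def)
  show "unshifted w"
  proof (rule ccontr)
    assume "\<not> unshifted w"
    with w obtain v where v: "is_dyck v" "w = shift v" by (rule dyck_shift_cases)
    then have "v = QDV (length v) p \<and> length p < length v"
      using shift_eq_QDV[OF p(1), of v "min_Delta p"] p(3) by (simp add: is_dyck_def)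
    then have "min_Delta p \<le> length v"
      unfolding min_Delta_def using v(1) by (intro Least_le) (metis is_dyck_def)
    moreover have "min_Delta p = length w" using p(3) by (metis length_QDV)
    ultimately show False using v(2) by simp
  qed
next
  assume u: "unshifted w"
  then have w: "is_dyck w" by (simp add: unshifted_def)
  then obtain p where p: "is_partition p" "length p < length w" "w = QDV (length w) p"
    using qdv_eq_QDV is_dyck_def by blast
  have "min_Delta p = length w"
    unfolding min_Delta_def
  proof (rule Least_equality)
    show "length p < length w \<and> (\<forall>x\<in>set (QDV (length w) p). 0 \<le> x)"
      using p w by (metis is_dyck_def)
    fix m assume m: "length p < m \<and> (\<forall>x\<in>set (QDV m p). 0 \<le> x)"
    show "length w \<le> m"
    proof (rule ccontr)
      assume "\<not> length w \<le> m"
      then obtain k where k: "length w = m + Suc k" using less_imp_Suc_add[of m "length w"] by auto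
      have "is_dyck (QDV m p)" using m p(1) is_qdv_QDV by (simp add: is_dyck_def)
      moreover have "w = shift ((shift ^^ k) (QDV m p))"
        using funpow_shift_QDV[of p m "Suc k"] m k p(3) by simp
      ultimately show False using u not_unshifted_shift is_dyck_funpow_shift by blast
    qed
  qed
  then show "is_reduced w"
    using p w partition_class_eq[OF p(1,2)] by (auto simp: is_reduced_def reduced_dyck_vector_def)
qed

section \<open>The map \<open>NU1\<close> on partitions and on words\<close>

lemma part_Cons: "part (x # xs) (Suc k) = (if k = 0 then x else part xs k)"
  by (auto simp: part_def nth_Cons split: nat.split)

text \<open>In a weakly decreasing list the zeros come last, so dropping them agrees with the zero
  padding in \<open>part\<close>.\<close>

lemma part_filter_pos:
  assumes "sorted_wrt (\<ge>) xs"
  shows "part (filter (\<lambda>k. 0 < k) xs) i = part xs i"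
  using assms
proof (induction xs arbitrary: i)
  case (Cons x xs)
  show ?case
  proof (cases "x = 0")
    case True
    then have "\<forall>y\<in>set (x # xs). y = 0" using Cons.prems by auto
    then have "filter (\<lambda>k. 0 < k) (x # xs) = []" by (simp add: filter_empty_conv)
    moreover have "part (x # xs) i = 0"
      using \<open>\<forall>y\<in>set (x # xs). y = 0\<close> nth_mem[of "i - 1" "x # xs"] by (auto simp: part_def)
    ultimately show ?thesis by (simp add: part_def)
  next
    case False
    then show ?thesis
      using Cons by (cases i) (simp_all add: part_Cons, simp add: part_def)
  qed
qed simp

lemma part_map_pred: "part (map (\<lambda>k. k - 1) p) i = part p i - 1"
  by (auto simp: part_def)

lemma is_partition_Cons:
  "is_partition (x # p) \<longleftrightarrow> 0 < x \<and> part p 1 \<le> x \<and> is_partition p"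
  by (cases p) (auto simp: is_partition_def part_def)

lemma sorted_map_pred: "is_partition p \<Longrightarrow> sorted_wrt (\<ge>) (map (\<lambda>k. k - 1) p)"
  by (auto simp: is_partition_def sorted_wrt_map elim: sorted_wrt_mono_rel[rotated])

lemma part_NU1:
  assumes "is_partition p"
  shows "part (NU1 p) (Suc i) = (if i = 0 then length p + 1 else part p i - 1)"
  by (simp only: NU1_def part_Cons part_filter_pos[OF sorted_map_pred[OF assms]] part_map_pred)

text \<open>The domain condition says exactly that the new first part \<open>length p + 1\<close> is
  at least \<open>part p 1 - 1\<close>.\<close>

lemma is_partition_NU1:
  assumes "NU1_defined p"
  shows "is_partition (NU1 p)"
proof -
  have p: "is_partition p" "part p 1 \<le> length p + 2" using assms by (auto simp: NU1_defined_def)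
  have "is_partition (filter (\<lambda>k. 0 < k) (map (\<lambda>k. k - 1) p))"
    using sorted_wrt_filter[OF sorted_map_pred[OF p(1)]] by (auto simp: is_partition_def)
  moreover have "part (filter (\<lambda>k. 0 < k) (map (\<lambda>k. k - 1) p)) 1 \<le> length p + 1"
    unfolding part_filter_pos[OF sorted_map_pred[OF p(1)]] part_map_pred using p(2) by simp
  ultimately show ?thesis by (simp add: NU1_def is_partition_Cons)
qed

lemma length_NU1: "length (NU1 p) \<le> length p + 1"
  using length_filter_le[of "\<lambda>k. 0 < k" "map (\<lambda>k. k - 1) p"] by (simp add: NU1_def)

text \<open>Lowering a part by 1 raises its entry by 1, and the new largest part
  \<open>length p + 1\<close> cancels the last index, which gives the final 0.\<close>

lemma QDV_NU1:
  assumes p: "is_partition p" and R: "0 # R = QDV (length p + 1) p"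
  shows "QDV (length p + 2) (NU1 p) = 0 # plus_word R @ [0]"
proof (rule nth_equalityI)
  have len: "length R = length p" using arg_cong[OF R, of length] by simp
  show "length (QDV (length p + 2) (NU1 p)) = length (0 # plus_word R @ [0])"
    by (simp add: len)
  fix i assume "i < length (QDV (length p + 2) (NU1 p))"
  then consider "i = 0" | "i = length p + 1" | j where "i = Suc j" "j < length p" by (cases i) (auto simp: less_Suc_eq)
  then show "QDV (length p + 2) (NU1 p) ! i = (0 # plus_word R @ [0]) ! i"
  proof cases
    case 1
    then show ?thesis using length_NU1[of p] by (simp add: QDV_nth part_def)
  next
    case 2
    then show ?thesis using part_NU1[OF p, of 0] by (simp add: QDV_nth nth_append len)
  next
    case 3
    have "part (NU1 p) (length p + 2 - i) = part p (length p - j) - 1"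
      using 3 part_NU1[OF p, of "length p - j"] by (simp add: Suc_diff_le)
    \<comment> \<open>Positivity makes the truncated subtraction of 1 exact.\<close>
    moreover have "part p (length p - j) \<ge> 1"
      using part_pos_iff[OF p, of "length p - j"] 3 by (simp add: Suc_le_eq)
    moreover have "R ! j = int (Suc j) - int (part p (length p - j))"
      using arg_cong[OF R, of "\<lambda>v. v ! Suc j"] 3 by (simp add: QDV_nth)
    ultimately show ?thesis
      using 3 by (simp add: QDV_nth nth_append len plus_word_def)
  qed
qed

lemma NU1_class_partition_class:
  assumes "NU1_defined p"
  shows "NU1_class (partition_class p) D \<longleftrightarrow> D = partition_class (NU1 p)"
  using assms partition_class_inject unfolding NU1_class_def NU1_defined_def by metis

text \<open>The side conditions are statements about the partition \<open>p\<close> of the class. A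
  nonpositive head of \<open>R\<close> makes part number \<open>length R\<close> positive, so
  \<open>length p = length R\<close>. The last entry is then \<open>length R - part p 1\<close>, and
  the bound -2 is the domain condition of \<open>NU1\<close>.\<close>

lemma NU1_class_iff:
  assumes R: "is_qdv (0 # R)" "R = [] \<or> hd R \<le> 0" "last (0 # R) \<ge> -2"
  shows "NU1_class (dyck_class (0 # R)) D \<longleftrightarrow> D = dyck_class (0 # plus_word R @ [0])"
proof -
  from qdv_eq_QDV[OF R(1)] obtain p where
    p: "is_partition p" "length p < length (0 # R)" "0 # R = QDV (length (0 # R)) p" by blast
  have len: "length p = length R"
  proof (cases "R = []")
    case False
    then have "R ! 0 \<le> 0" using R(2) by (simp add: hd_conv_nth)
    then have "part p (length R) > 0"
      using arg_cong[OF p(3), of "\<lambda>v. v ! 1"] False by (simp add: QDV_nth)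
    then show ?thesis using part_pos_iff[OF p(1), of "length R"] p(2) by simp
  qed (use p(2) in simp)
  have "last (0 # R) = (0 # R) ! length R"
    by (metis diff_Suc_1 last_conv_nth length_Cons list.discI)
  also have "\<dots> = QDV (length (0 # R)) p ! length R"
    using arg_cong[OF p(3), of "\<lambda>v. v ! length R"] .
  finally have "last (0 # R) = int (length R) - int (part p 1)" by (simp add: QDV_nth)
  then have def: "NU1_defined p" using p(1) R(3) len by (simp add: NU1_defined_def)
  have eq: "0 # R = QDV (length p + 1) p" using p(3) len by simp
  have "partition_class p = dyck_class (0 # R)"
    using partition_class_eq[OF p(1), of "length p + 1"] eq by simp
  moreover have "partition_class (NU1 p) = dyck_class (0 # plus_word R @ [0])"
    using partition_class_eq[OF is_partition_NU1[OF def], of "length p + 2"] length_NU1[of p]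
    by (simp flip: QDV_NU1[OF p(1) eq])
  ultimately show ?thesis using NU1_class_partition_class[OF def] by simp
qed

lemma is_qdv_shift_Cons: "is_qdv (shift (0 # R)) \<Longrightarrow> is_qdv (0 # R)"
  unfolding is_qdv_shift by (simp add: is_qdv_iff_successively)

text \<open>Since \<open>0 # 1 # T\<close> is the shift of \<open>0 # R\<close> with
  \<open>T = plus_word R\<close>, this is the previous rule with its bounds raised by 1.\<close>

lemma NU1_class_word:
  assumes T: "is_qdv (0 # 1 # T)" "T = [] \<or> hd T \<le> 1" "T = [] \<or> last T \<ge> -1"
  shows "NU1_class (dyck_class (0 # 1 # T)) D \<longleftrightarrow> D = dyck_class (0 # T @ [0])"
proof -
  define R where "R = map (\<lambda>x. x - 1) T"
  have T_eq: "T = plus_word R" by (simp add: R_def)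
  have sh: "0 # 1 # T = shift (0 # R)" by (simp add: shift_def T_eq)
  have qdv: "is_qdv (0 # R)" using T(1) unfolding sh by (rule is_qdv_shift_Cons)
  have "R = [] \<or> hd R \<le> 0" "last (0 # R) \<ge> -2"
    using T(2,3) by (cases "T = []"; simp add: R_def hd_map last_map)+
  then show ?thesis
    unfolding sh dyck_class_shift[OF qdv] using NU1_class_iff[OF qdv] by (simp add: T_eq)
qed

section \<open>Stages of a tail\<close>

definition block_word :: "int list \<Rightarrow> bool" where
  "block_word R \<longleftrightarrow> set R \<subseteq> {0, 1} \<and> (R = [] \<or> hd R = 0)"

text \<open>\<open>NU1\<close> moves the letters of \<open>Q\<close> one at a time to the end of \<open>P\<close>; once \<open>Q\<close> is empty, it goes on
  with \<open>P @ [0]\<close> in the role of \<open>Q\<close>.\<close>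

definition stage :: "int list \<Rightarrow> int list \<Rightarrow> int list" where
  "stage Q P = 0 # 1 # plus_word Q @ P"

lemma binary_successively: "set Q \<subseteq> {0, 1} \<Longrightarrow> successively (\<lambda>x y. y \<le> x + 1) (Q :: int list)"
  by (induction Q rule: induct_list012) auto

lemma last_binary: "set Q \<subseteq> {0, 1} \<Longrightarrow> Q = [] \<or> last Q = 0 \<or> last Q = (1 :: int)"
  using last_in_set by blast

lemma hd_binary: "set Q \<subseteq> {0, 1} \<Longrightarrow> Q = [] \<or> hd Q = 0 \<or> hd Q = (1 :: int)"
  using hd_in_set by blast

lemma last_plus_word: "v \<noteq> [] \<Longrightarrow> last (plus_word v) = last v + 1"
  by (simp add: plus_word_def last_map)

lemma block_word_append:
  "block_word (P @ Q) \<longleftrightarrow> block_word P \<and> set Q \<subseteq> {0, 1} \<and> (P = [] \<longrightarrow> Q = [] \<or> hd Q = 0)"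
  by (cases P) (auto simp: block_word_def)

text \<open>No junction rises by more than 1: the leading 1 meets entries 1 or 2 of
  \<open>plus_word Q\<close>, and these meet entries 0 or 1 of \<open>P\<close>.\<close>

lemma is_qdv_stage:
  assumes "set Q \<subseteq> {0, 1}" "set P \<subseteq> {0, 1}"
  shows "is_qdv (stage Q P)"
  using assms binary_successively[of Q] binary_successively[of P]
    last_binary[of Q] hd_binary[of P] hd_binary[of Q]
  by (auto simp: is_qdv_iff_successively stage_def successively_Cons successively_append_iff
      hd_append hd_plus_word last_plus_word)

lemma stage_Nil: "stage Q [] = shift (0 # Q)"
  by (simp add: stage_def shift_def)

lemma dyck_class_stage_Nil:
  assumes "set Q \<subseteq> {0, 1}"
  shows "dyck_class (stage Q []) = dyck_class (0 # Q)"
  using is_qdv_stage[OF assms, of "[]"] dyck_class_shift is_qdv_shift_Cons by (simp add: stage_Nil)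

text \<open>A letter 0 of \<open>Q\<close> stands in the stage as 1, so \<open>NU1\<close> drops a 1
  and appends a 0 directly. A letter 1 stands there as 2; then one shift is undone first, and the 0
  that \<open>NU1\<close> appends becomes 1 when the shift is restored.\<close>

lemma NU1_class_stage_Cons:
  assumes "block_word (P @ a # Q)"
  shows "NU1_class (dyck_class (stage (a # Q) P)) D \<longleftrightarrow> D = dyck_class (stage Q (P @ [a]))"
proof -
  have bin: "set (a # Q) \<subseteq> {0, 1}" "set P \<subseteq> {0, 1}"
    using assms by (auto simp: block_word_def)
  have qdv: "is_qdv (stage (a # Q) P)" "is_qdv (stage Q (P @ [a]))"
    using bin by (auto intro!: is_qdv_stage)
  show ?thesis
  proof (cases "a = 0")
    case True
    have eq: "stage (a # Q) P = 0 # 1 # 1 # plus_word Q @ P" by (simp add: stage_def True)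
    have last: "last (1 # plus_word Q @ P) \<ge> -1"
      using last_binary[OF bin(2)] last_binary[of Q] bin(1) by (auto simp: last_plus_word last_append)
    have "stage Q (P @ [a]) = 0 # (1 # plus_word Q @ P) @ [0]"
      by (simp add: stage_def True)
    then show ?thesis
      unfolding eq by (subst NU1_class_word) (use qdv(1) last eq in auto)
  next
    case False
    then have a: "a = 1" using bin by simp
    \<comment> \<open>Entries of \<open>P'\<close> may be -1, so the vector obtained by undoing the
      shift is a QDV but possibly no Dyck vector; this is why \<open>NU1_class_word\<close> admits a
      last entry -1.\<close>
    define P' where "P' = map (\<lambda>x. x - 1) P"
    have P: "P = plus_word P'" by (simp add: P'_def)
    have hdP: "P = [] \<or> hd P = 0" using assms by (cases P) (auto simp: block_word_def)
    have eq: "stage (a # Q) P = shift (0 # 1 # Q @ P')"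
      by (simp add: stage_def shift_def a P)
    have eq2: "stage Q (P @ [a]) = shift (0 # (Q @ P') @ [0])"
      by (simp add: stage_def shift_def a P)
    have q: "is_qdv (0 # 1 # Q @ P')" "is_qdv (0 # (Q @ P') @ [0])"
      using qdv unfolding eq eq2 by (auto dest: is_qdv_shift_Cons)
    have "Q @ P' = [] \<or> hd (Q @ P') \<le> 1"
      using hdP hd_binary[of Q] bin(1) by (cases P; cases Q) (auto simp: P'_def)
    moreover have "Q @ P' = [] \<or> last (Q @ P') \<ge> -1"
      using last_binary[OF bin(2)] last_binary[of Q] bin(1) by (auto simp: P'_def last_append last_map)
    ultimately show ?thesis
      unfolding eq eq2 dyck_class_shift[OF q(1)] dyck_class_shift[OF q(2)]
      using NU1_class_word[OF q(1)] by blast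
  qed
qed

text \<open>Here \<open>NU1\<close> turns \<open>0 # 1 # P\<close> into \<open>0 # P @ [0]\<close>,
  whose shift is the stage that opens the next round.\<close>

lemma NU1_class_stage_Nil:
  assumes "block_word P"
  shows "NU1_class (dyck_class (stage [] P)) D \<longleftrightarrow> D = dyck_class (stage (P @ [0]) [])"
proof -
  have bin: "set P \<subseteq> {0, 1}" "P = [] \<or> hd P = 0" using assms by (auto simp: block_word_def)
  have eq: "stage [] P = 0 # 1 # P" by (simp add: stage_def)
  show ?thesis
    unfolding eq
    by (subst NU1_class_word)
      (use bin last_binary[OF bin(1)] is_qdv_stage[of "[]" P] in \<open>auto simp: eq dyck_class_stage_Nil\<close>)
qed

lemma block_word_B_word: "block_word (B_word p @ replicate k 0)"
proof -
  have "B_word p = [] \<or> hd (B_word p) = 0"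
    by (cases "part p 1 = 0") (simp_all add: B_word_def upt_conv_Cons del: upt_Suc)
  moreover have "set (B_word p) \<subseteq> {0, 1}" by (auto simp: B_word_def)
  ultimately show ?thesis by (cases k) (auto simp: block_word_def hd_append)
qed

text \<open>The stages are closed under \<open>NU1\<close> by the two preceding rules, and
  \<open>k\<close> grows whenever \<open>Q\<close> is exhausted. Conversely, \<open>start\<close>
  reaches the opening of each round and \<open>along\<close> reaches every stage within a
  round.\<close>

lemma TAIL_eq:
  "TAIL p = {dyck_class (stage Q P) | P Q k. P @ Q = B_word p @ replicate k 0}"
proof (intro equalityI subsetI)
  have TI: "TI p = dyck_class (stage (B_word p) [])"
    using block_word_B_word[of p 0] by (simp add: TI_def dyck_class_stage_Nil block_word_def)
  {
    fix C assume "C \<in> TAIL p"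
    then have "NU1_class\<^sup>*\<^sup>* (TI p) C" by (simp add: TAIL_def)
    then show "C \<in> {dyck_class (stage Q P) | P Q k. P @ Q = B_word p @ replicate k 0}"
    proof (induction rule: rtranclp_induct)
      case base
      then show ?case unfolding TI by simp (metis append_Nil append_Nil2 replicate_0)
    next
      case (step C D)
      then obtain P Q k where C: "C = dyck_class (stage Q P)" and
        PQ: "P @ Q = B_word p @ replicate k 0" by blast
      then have b: "block_word (P @ Q)" using block_word_B_word by metis
      show ?case
      proof (cases Q)
        case Nil
        then have "D = dyck_class (stage (P @ [0]) [])"
          using step.hyps(2) b NU1_class_stage_Nil C by simp
        moreover have "[] @ (P @ [0]) = B_word p @ replicate (Suc k) 0"
          using PQ Nil by (simp flip: replicate_append_same)
        ultimately show ?thesis by blast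
      next
        case (Cons a Q')
        then have "D = dyck_class (stage Q' (P @ [a]))"
          using step.hyps(2) b NU1_class_stage_Cons C by simp
        moreover have "(P @ [a]) @ Q' = B_word p @ replicate k 0" using PQ Cons by simp
        ultimately show ?thesis by blast
      qed
    qed
  }
  have along: "NU1_class\<^sup>*\<^sup>* (dyck_class (stage (P @ Q) [])) (dyck_class (stage Q P))"
    if "block_word (P @ Q)" for P Q
    using that
  proof (induction P arbitrary: Q rule: rev_induct)
    case (snoc a P)
    then show ?case
      using NU1_class_stage_Cons[of P a Q] snoc.IH[of "a # Q"] by (auto intro: rtranclp.rtrancl_into_rtrancl)
  qed simp
  have start: "NU1_class\<^sup>*\<^sup>* (TI p) (dyck_class (stage (B_word p @ replicate k 0) []))" for k
  proof (induction k)
    case (Suc k)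
    let ?R = "B_word p @ replicate k 0"
    have "NU1_class\<^sup>*\<^sup>* (TI p) (dyck_class (stage [] ?R))"
      using Suc along[of ?R "[]"] block_word_B_word[of p k] by simp
    moreover have "NU1_class (dyck_class (stage [] ?R)) (dyck_class (stage (?R @ [0]) []))"
      using NU1_class_stage_Nil block_word_B_word by blast
    ultimately show ?case by (simp add: replicate_append_same rtranclp.rtrancl_into_rtrancl)
  qed (simp add: TI)
  fix C assume "C \<in> {dyck_class (stage Q P) | P Q k. P @ Q = B_word p @ replicate k 0}"
  then obtain P Q k where C: "C = dyck_class (stage Q P)" and
    PQ: "P @ Q = B_word p @ replicate k 0" by blast
  then show "C \<in> TAIL p"
    using start[of k] along[of P Q] block_word_B_word[of p k] by (simp add: TAIL_def)
qed

section \<open>Coding of partitions by binary words\<close>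

lemma part_le_part_1:
  assumes "is_partition p" "k \<in> set p"
  shows "k \<le> part p 1"
  using assms by (cases p) (auto simp: is_partition_def part_def)

lemma B_word_Nil [simp]: "B_word [] = []"
  by (simp add: B_word_def part_def)

text \<open>A new largest part leaves the earlier blocks unchanged, opens \<open>k\<close> new
  blocks, and puts a 1 at the end of the last block. For \<open>k = 0\<close> this 1 joins the block
  that is already last.\<close>

lemma B_word_Cons:
  assumes p: "is_partition p" and pos: "0 < part p 1 + k"
  shows "B_word ((part p 1 + k) # p) = B_word p @ replicate k 0 @ [1]"
proof -
  define m where "m = part p 1"
  have zero: "count_list p i = 0" if "m < i" for i
    using part_le_part_1[OF p] that unfolding m_def by (metis count_list_0_iff leD)
  define f :: "nat list \<Rightarrow> nat \<Rightarrow> int list" where "f q i = 0 # replicate (count_list q i) 1" for q i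
  let ?q = "(m + k) # p"
  have part1: "part ?q 1 = m + k" by (simp add: part_def)
  have B: "B_word q = concat (map (f q) [1..<part q 1 + 1])" for q
    unfolding B_word_def f_def ..
  have last: "f ?q (m + k) = f p (m + k) @ [1]"
    by (simp add: f_def replicate_append_same)
  have same: "map (f ?q) [a..<m + k] = map (f p) [a..<m + k]" for a
    by (simp add: f_def)
  have split: "[1..<m + k + 1] = [1..<m + k] @ [m + k]" using pos by (simp add: m_def Suc_le_eq del: add_gr_0)
  have "B_word ?q = concat (map (f p) [1..<m + k + 1]) @ [1]"
    unfolding B part1 split by (simp add: last same)
  also have "[1..<m + k + 1] = [1..<m + 1] @ [m + 1..<m + 1 + k]"
    by (metis add.assoc add.commute le_add2 upt_add_eq_append)
  also have "map (f p) ([1..<m + 1] @ [m + 1..<m + 1 + k]) =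
      map (f p) [1..<m + 1] @ map (f p) [m + 1..<m + 1 + k]"
    by (rule map_append)
  also have "map (f p) [m + 1..<m + 1 + k] = replicate k [0]"
    by (rule nth_equalityI) (simp_all add: f_def zero del: upt_Suc)
  finally have "B_word ?q = concat (map (f p) [1..<m + 1]) @ concat (replicate k [0]) @ [1]"
    by (simp only: concat_append append_assoc)
  moreover have "concat (replicate k [0]) = replicate k (0 :: int)" by (induction k) simp_all
  ultimately show ?thesis unfolding m_def B[of p] by (simp only:)
qed

text \<open>The word is read from the left. A new 0 is one more trailing zero; a new 1 turns the
  \<open>k\<close> trailing zeros into blocks, that is, adds a part \<open>part p 1 + k\<close>. The
  first letter is never 1, so that part is positive.\<close>

lemma block_word_eq_B_word:
  assumes "block_word R"
  shows "\<exists>p k. is_partition p \<and> R = B_word p @ replicate k 0"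
  using assms
proof (induction R rule: rev_induct)
  case Nil
  have "is_partition [] \<and> [] = B_word [] @ replicate 0 0"
    by (simp add: is_partition_def B_word_def part_def)
  then show ?case by blast
next
  case (snoc a R)
  then have "block_word R" "a \<in> {0, 1}" by (auto simp: block_word_append)
  with snoc.IH obtain p k where p: "is_partition p" "R = B_word p @ replicate k 0" by blast
  show ?case
  proof (cases "a = 0")
    case True
    then have "R @ [a] = B_word p @ replicate (Suc k) 0"
      using p(2) by (simp flip: replicate_append_same)
    with p(1) show ?thesis by blast
  next
    case False
    then have a: "a = 1" using \<open>a \<in> {0, 1}\<close> by simp
    have pos: "0 < part p 1 + k"
    proof (rule ccontr)
      assume "\<not> 0 < part p 1 + k"
      then have "R = []" using p(2) by (simp add: B_word_def)
      then show False using snoc.prems a by (simp add: block_word_def)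
    qed
    have "is_partition ((part p 1 + k) # p)" using p(1) pos by (simp add: is_partition_Cons)
    moreover have "R @ [a] = B_word ((part p 1 + k) # p) @ replicate 0 0"
      using B_word_Cons[OF p(1) pos] p(2) a by simp
    ultimately show ?thesis by blast
  qed
qed

text \<open>A word is cut uniquely at its last letter different from \<open>z\<close>; below, this
  locates the last 1 before the trailing zeros.\<close>

lemma append_replicate_eq:
  assumes "xs @ x # replicate k z = ys @ y # replicate j z" "x \<noteq> z" "y \<noteq> z"
  shows "xs = ys \<and> x = y"
proof -
  have "dropWhile (\<lambda>a. a = z) (rev (us @ u # replicate i z)) = u # rev us" if "u \<noteq> z" for us u i
  proof -
    have "dropWhile (\<lambda>a. a = z) (replicate i z @ u # rev us) = u # rev us"
      using that by (induction i) simp_all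
    then show ?thesis by simp
  qed
  then show ?thesis using assms by (metis list.inject rev_rev_ident)
qed

text \<open>Deleting everything from the last 1 on removes a largest part on both sides and leaves
  words of the same kind, so induction applies. The zeros uncovered at the end then determine the
  removed part. Only the zero partition gives a word without 1.\<close>

lemma B_word_inject:
  assumes "is_partition p" "is_partition q" "B_word p @ replicate k 0 = B_word q @ replicate j 0"
  shows "p = q"
  using assms
proof (induction p arbitrary: q k j)
  case Nil
  have "set (B_word q) \<subseteq> set (replicate k 0)"
    using Nil(3) by (metis B_word_Nil append_Nil set_append Un_upper1)
  then have no_one: "1 \<notin> set (B_word q)" by auto
  show ?case
  proof (cases q)
    case (Cons y q')
    then obtain b where "y = part q' 1 + b" "is_partition q'" "0 < y"
      using Nil(2) by (metis is_partition_Cons le_Suc_ex)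
    then show ?thesis using B_word_Cons[of q' b] no_one Cons by simp
  qed simp
next
  case (Cons x p)
  then obtain a where a: "x = part p 1 + a" "is_partition p" "0 < x"
    by (metis is_partition_Cons le_Suc_ex)
  then have x: "B_word (x # p) = B_word p @ replicate a 0 @ [1]"
    using B_word_Cons[of p a] by simp
  show ?case
  proof (cases q)
    case Nil
    then have "set (B_word (x # p)) \<subseteq> set (replicate j 0)"
      using Cons.prems(3) by (metis B_word_Nil append_Nil set_append Un_upper1)
    then have "1 \<notin> set (B_word (x # p))" by auto
    then show ?thesis using x by simp
  next
    case q: (Cons y q')
    then obtain b where b: "y = part q' 1 + b" "is_partition q'" "0 < y"
      using Cons.prems(2) by (metis is_partition_Cons le_Suc_ex)
    then have y: "B_word q = B_word q' @ replicate b 0 @ [1]"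
      using B_word_Cons[of q' b] q by simp
    have eq: "B_word p @ replicate a 0 = B_word q' @ replicate b 0"
      using append_replicate_eq[of "B_word p @ replicate a 0" 1 k 0 "B_word q' @ replicate b 0" 1 j]
        Cons.prems(3) x y by simp
    then have "p = q'" using Cons.IH a b by blast
    then have "a = b" using arg_cong[OF eq, of length] by simp
    then show ?thesis using \<open>p = q'\<close> a b q by simp
  qed
qed

section \<open>Recovering the stage and the partition from a class\<close>

text \<open>\<open>stage Q []\<close> is the shift of \<open>0 # Q\<close>, so the unshifted representative needs a case distinction.\<close>

definition stage_rep :: "int list \<Rightarrow> int list \<Rightarrow> int list" where
  "stage_rep Q P = (if P = [] then 0 # Q else stage Q P)"

lemma dyck_class_stage_rep:
  "block_word (P @ Q) \<Longrightarrow> dyck_class (stage_rep Q P) = dyck_class (stage Q P)"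
  by (simp add: stage_rep_def dyck_class_stage_Nil block_word_append)

text \<open>The second 0 is the first letter of \<open>P\<close>, or of \<open>Q\<close> if
  \<open>P\<close> is empty; if both are empty, the vector is \<open>[0]\<close>.\<close>

lemma unshifted_stage_rep:
  assumes b: "block_word (P @ Q)"
  shows "unshifted (stage_rep Q P)"
proof (cases "P = []")
  case True
  then have "set Q \<subseteq> {0, 1}" "Q = [] \<or> hd Q = 0" using b by (auto simp: block_word_def)
  then show ?thesis
    using is_qdv_shift_Cons[of Q] is_qdv_stage[of Q "[]"] True
    by (cases Q) (auto simp: stage_rep_def unshifted_def is_dyck_def stage_Nil)
next
  case False
  then have "set Q \<subseteq> {0, 1}" "set P \<subseteq> {0, 1}" "hd P = 0" using b by (auto simp: block_word_def)
  then show ?thesis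
    using False is_qdv_stage[of Q P] hd_in_set[OF False]
    by (auto simp: stage_rep_def unshifted_def is_dyck_def) (auto simp: stage_def)
qed

text \<open>After the prefix 0 1, the first 0 marks the boundary, since \<open>plus_word Q\<close>
  has no 0 and \<open>P\<close> begins with 0. An empty \<open>P\<close> is recognised by a second
  entry that is 0 or missing.\<close>

lemma stage_rep_inject:
  assumes b: "block_word (P @ Q)" "block_word (P' @ Q')" and eq: "stage_rep Q P = stage_rep Q' P'"
  shows "P @ Q = P' @ Q'"
proof -
  have take: "takeWhile (\<lambda>x. x \<noteq> 0) (plus_word U @ V) = plus_word U"
    if "block_word (V @ U)" "V \<noteq> []" for U V
  proof -
    have "set U \<subseteq> {0, 1}" "hd V = 0" using that by (auto simp: block_word_def)
    then have "\<forall>x\<in>set (plus_word U). x \<noteq> 0" by auto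
    then have "takeWhile (\<lambda>x. x \<noteq> 0) (plus_word U @ V) = plus_word U @ takeWhile (\<lambda>x. x \<noteq> 0) V"
      by (intro takeWhile_append2) blast
    then show ?thesis using \<open>hd V = 0\<close> that(2) by (cases V) simp_all
  qed
  show ?thesis
  proof (cases "P = [] \<or> P' = []")
    case True
    then show ?thesis using b eq by (auto simp: stage_rep_def stage_def block_word_def split: if_splits)
  next
    case False
    then have e: "plus_word Q @ P = plus_word Q' @ P'" using eq by (simp add: stage_rep_def stage_def)
    then have "plus_word Q = plus_word Q'" using take[of P Q] take[of P' Q'] b False by metis
    then have "Q = Q'" using shift_inject[of Q Q'] by (simp add: shift_def)
    then show ?thesis using e by simp
  qed
qed

lemma mem_TAIL_iff:
  "C \<in> TAIL p \<longleftrightarrow> (\<exists>P Q k. C = dyck_class (stage_rep Q P) \<and> P @ Q = B_word p @ replicate k 0)"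
proof -
  have "dyck_class (stage_rep Q P) = dyck_class (stage Q P)"
    if "P @ Q = B_word p @ replicate k 0" for P Q k
    using dyck_class_stage_rep block_word_B_word that by metis
  then show ?thesis unfolding TAIL_eq mem_Collect_eq by metis
qed

lemma TAIL_unique:
  assumes "is_partition p" "is_partition q" "C \<in> TAIL p" "C \<in> TAIL q"
  shows "p = q"
proof -
  obtain P Q k where 1: "C = dyck_class (stage_rep Q P)" "P @ Q = B_word p @ replicate k 0"
    using assms(3) by (auto simp: mem_TAIL_iff)
  obtain P' Q' j where 2: "C = dyck_class (stage_rep Q' P')" "P' @ Q' = B_word q @ replicate j 0"
    using assms(4) by (auto simp: mem_TAIL_iff)
  have b: "block_word (P @ Q)" "block_word (P' @ Q')"
    using 1(2) 2(2) block_word_B_word by metis+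
  have "stage_rep Q P = stage_rep Q' P'"
    using unshifted_unique unshifted_stage_rep b 1(1) 2(1) by metis
  then have "B_word p @ replicate k 0 = B_word q @ replicate j 0"
    using stage_rep_inject[OF b] 1(2) 2(2) by simp
  then show ?thesis using B_word_inject assms(1,2) by blast
qed

section \<open>Membership of binary and ternary vectors\<close>

lemma stage_in_TAIL:
  assumes "block_word (P @ Q)"
  shows "\<exists>p. is_partition p \<and> dyck_class (stage Q P) \<in> TAIL p"
  using block_word_eq_B_word[OF assms] unfolding TAIL_eq by blast

text \<open>Cutting \<open>T\<close> at its first 0 shows the vector as a stage. If \<open>T\<close>
  has no 0, then \<open>P\<close> is empty and \<open>Q\<close> itself must begin with 0 or be
  empty, which is where a leading 2 in \<open>T\<close> is excluded.\<close>

lemma zero_one_in_TAIL: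
  assumes T: "set (takeWhile (\<lambda>x. x \<noteq> 0) T) \<subseteq> {1, 2}" "set (dropWhile (\<lambda>x. x \<noteq> 0) T) \<subseteq> {0, 1}"
    "T = [] \<or> hd T \<noteq> 2 \<or> 0 \<in> set T"
  shows "\<exists>p. is_partition p \<and> dyck_class (0 # 1 # T) \<in> TAIL p"
proof -
  define Q where "Q = map (\<lambda>x. x - 1) (takeWhile (\<lambda>x. x \<noteq> 0) T)"
  define P where "P = dropWhile (\<lambda>x. x \<noteq> 0) T"
  have stage: "0 # 1 # T = stage Q P" by (simp add: stage_def Q_def P_def)
  have bin: "set (P @ Q) \<subseteq> {0, 1}" using T(1,2) by (auto simp: Q_def P_def)
  have "P @ Q = [] \<or> hd (P @ Q) = 0"
  proof (cases "0 \<in> set T")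
    case True
    then have "P \<noteq> []" by (auto simp: P_def dropWhile_eq_Nil_conv)
    then show ?thesis using hd_dropWhile[of "\<lambda>x. x \<noteq> 0" T] by (simp add: P_def)
  next
    case False
    then have take: "takeWhile (\<lambda>x. x \<noteq> 0) T = T" and "P = []"
      by (auto simp: P_def takeWhile_eq_all_conv dropWhile_eq_Nil_conv)
    moreover have "T = [] \<or> hd T = 1" using T(1,3) False unfolding take by (cases T) auto
    ultimately show ?thesis unfolding Q_def take by (cases "T = []") (auto simp: hd_map)
  qed
  then show ?thesis unfolding stage using bin by (intro stage_in_TAIL) (simp add: block_word_def)
qed

text \<open>If \<open>Q\<close> is a block word, the class is that of a stage with empty
  \<open>P\<close>; otherwise the vector begins with 0 1 and is itself a stage.\<close>

lemma binary_in_TAIL: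
  assumes "is_binary_dyck w"
  shows "\<exists>p. is_partition p \<and> dyck_class w \<in> TAIL p"
proof -
  obtain Q where w: "w = 0 # Q"
    using assms by (cases w) (auto simp: is_binary_dyck_def is_dyck_def is_qdv_def)
  have Q: "set Q \<subseteq> {0, 1}" using assms w by (simp add: is_binary_dyck_def)
  show ?thesis
  proof (cases "Q = [] \<or> hd Q = 0")
    case True
    then have "block_word ([] @ Q)" using Q by (simp add: block_word_def)
    then show ?thesis using stage_in_TAIL dyck_class_stage_Nil[OF Q] w by metis
  next
    case False
    then obtain T where T: "Q = 1 # T" using hd_binary[OF Q] by (cases Q) auto
    have "set (takeWhile (\<lambda>x. x \<noteq> 0) T) \<subseteq> {1, 2}"
      using Q T set_takeWhileD[of _ "\<lambda>x. x \<noteq> 0" T] by auto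
    moreover have "set (dropWhile (\<lambda>x. x \<noteq> 0) T) \<subseteq> {0, 1}"
      using Q T set_dropWhileD[of _ "\<lambda>x. x \<noteq> 0" T] by auto
    moreover have "T = [] \<or> hd T \<noteq> 2 \<or> 0 \<in> set T"
      using Q T by (cases T) auto
    ultimately show ?thesis using zero_one_in_TAIL w T by simp
  qed
qed

text \<open>Such a vector is the shift of a binary Dyck vector, which lies in the same
  class.\<close>

lemma nonreduced_ternary_in_TAIL:
  assumes "is_ternary_dyck w" "\<not> is_reduced w"
  shows "\<exists>p. is_partition p \<and> dyck_class w \<in> TAIL p"
proof -
  obtain v where v: "is_dyck v" "w = shift v"
    using assms dyck_shift_cases by (auto simp: is_ternary_dyck_def is_reduced_iff_unshifted)
  then have "x \<in> {0, 1}" if "x \<in> set v" for x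
    using assms(1) that by (force simp: is_ternary_dyck_def is_dyck_def shift_def)
  then have "is_binary_dyck v" using v(1) by (auto simp: is_binary_dyck_def)
  then show ?thesis using binary_in_TAIL v dyck_class_shift[of v] by (simp add: is_dyck_def)
qed

lemma last_two_props:
  assumes "2 \<in> set w"
  shows "last_two w < length w" "w ! last_two w = 2"
    "j < length w \<Longrightarrow> w ! j = 2 \<Longrightarrow> j \<le> last_two w"
proof -
  let ?S = "{j. j < length w \<and> w ! j = 2}"
  have "finite ?S" "?S \<noteq> {}" using assms by (auto simp: in_set_conv_nth)
  then have "last_two w \<in> ?S" unfolding last_two_def by (rule Max_in)
  then show "last_two w < length w" "w ! last_two w = 2" by auto
  show "j < length w \<Longrightarrow> w ! j = 2 \<Longrightarrow> j \<le> last_two w"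
    using \<open>finite ?S\<close> unfolding last_two_def by (intro Max_ge) auto
qed

text \<open>Being reduced, \<open>w\<close> has a second 0, and by hypothesis every 2 precedes it.
  Cutting there leaves a binary word after the cut and a word over 1 and 2 before it.\<close>

lemma reduced_ternary_in_TAIL:
  assumes w: "is_ternary_dyck w" "is_reduced w" "2 \<in> set w"
    and zero: "\<forall>i < last_two w. w ! i = 0 \<longleftrightarrow> i = 0"
  shows "\<exists>p. is_partition p \<and> dyck_class w \<in> TAIL p"
proof -
  have qdv: "is_qdv w" and set: "set w \<subseteq> {0, 1, 2}" using w(1) by (auto simp: is_ternary_dyck_def is_dyck_def)
  note L = last_two_props[OF w(3)]
  obtain u where u: "w = 0 # u" using qdv by (cases w) (auto simp: is_qdv_def)
  have pos: "last_two w > 0" using L(2) u by (cases "last_two w") auto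
  obtain b T where wT: "w = 0 # b # T" using L(1) pos u by (cases u) auto
  have "b \<noteq> 2" using qdv wT by (auto simp: is_qdv_iff_successively)
  \<comment> \<open>Either the last 2 is at position 1, where \<open>b\<close> stands, or position 1
    lies strictly before it and the zero condition applies.\<close>
  moreover have "b \<noteq> 0" using zero L(2) pos wT by (cases "last_two w = 1") (auto dest: spec[of _ 1])
  ultimately have b: "b = 1" using set wT by simp
  have zT: "0 \<in> set T" using w(2,3) wT b by (auto simp: is_reduced_iff_unshifted unshifted_def)
  \<comment> \<open>This is the position of the first 0 in \<open>T\<close>, hence position
    \<open>m + 2\<close> in \<open>w\<close>.\<close>
  define m where "m = length (takeWhile (\<lambda>x. x \<noteq> 0) T)"
  have "dropWhile (\<lambda>x. x \<noteq> 0) T \<noteq> []" using zT by (auto simp: dropWhile_eq_Nil_conv)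
  then have m: "m < length T"
    using arg_cong[OF takeWhile_dropWhile_id[of "\<lambda>x. x \<noteq> 0" T], of length]
    unfolding m_def length_append by (metis length_greater_0_conv less_add_same_cancel1)
  have Tm: "T ! m = 0"
    using m nth_length_takeWhile[of "\<lambda>x. x \<noteq> 0" T] by (simp add: m_def)
  have drop: "dropWhile (\<lambda>x. x \<noteq> 0) T = drop m T"
    by (simp add: m_def dropWhile_eq_drop)
  have no2: "T ! i \<noteq> 2" if "m \<le> i" "i < length T" for i
  proof
    assume "T ! i = 2"
    then have "i + 2 \<le> last_two w" using L(3)[of "i + 2"] wT that by simp
    then have "m + 2 < last_two w \<or> m = i" using that by linarith
    then show False
    proof
      assume "m + 2 < last_two w"
      then show False using zero Tm wT by (auto dest: spec[of _ "m + 2"])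
    qed (use Tm \<open>T ! i = 2\<close> in simp)
  qed
  have "x \<noteq> 2" if "x \<in> set (drop m T)" for x
    using that no2 by (auto simp: in_set_conv_nth)
  then have "set (dropWhile (\<lambda>x. x \<noteq> 0) T) \<subseteq> {0, 1}"
    using set wT set_drop_subset[of m T] unfolding drop by auto
  moreover have "set (takeWhile (\<lambda>x. x \<noteq> 0) T) \<subseteq> {1, 2}"
    using set wT set_takeWhileD[of _ "\<lambda>x. x \<noteq> 0" T] by auto
  ultimately show ?thesis using zero_one_in_TAIL zT wT b by simp
qed

text \<open>By uniqueness of unshifted vectors, \<open>w\<close> is the \<open>stage_rep\<close>
  itself. As \<open>0 # Q\<close> has no 2, \<open>P\<close> is nonempty; as \<open>P\<close> is
  binary, every 2 lies in \<open>plus_word Q\<close>, and up to the end of that segment only the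
  first entry of \<open>w\<close> is 0.\<close>

lemma TAIL_imp_zeros_before_last_two:
  assumes w: "is_reduced w" "2 \<in> set w" and tail: "dyck_class w \<in> TAIL p"
    and i: "i < last_two w"
  shows "w ! i = 0 \<longleftrightarrow> i = 0"
proof -
  obtain P Q k where PQ: "dyck_class w = dyck_class (stage_rep Q P)" "P @ Q = B_word p @ replicate k 0"
    using tail by (auto simp: mem_TAIL_iff)
  have b: "block_word (P @ Q)" using PQ(2) block_word_B_word by metis
  have eq: "w = stage_rep Q P"
    using unshifted_unique[OF _ unshifted_stage_rep[OF b] PQ(1)] w(1) by (simp add: is_reduced_iff_unshifted)
  have bin: "set P \<subseteq> {0, 1}" "set Q \<subseteq> {0, 1}" using b by (auto simp: block_word_def)
  have "P \<noteq> []" using eq w(2) bin by (auto simp: stage_rep_def)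
  then have wst: "w = 0 # 1 # plus_word Q @ P" using eq by (simp add: stage_rep_def stage_def)
  note L = last_two_props[OF w(2)]
  have "last_two w < length Q + 2"
  proof (rule ccontr)
    assume *: "\<not> last_two w < length Q + 2"
    then obtain j where j: "last_two w = length Q + 2 + j" using le_Suc_ex linorder_not_less by blast
    have "w ! (length Q + 2 + j) = P ! j" by (simp add: wst nth_append)
    moreover have "length w = length Q + 2 + length P" by (simp add: wst)
    ultimately have "P ! j = 2" "j < length P" using L(1,2) j by simp_all
    then have "2 \<in> set P" using nth_mem by metis
    then show False using bin by auto
  qed
  then have iQ: "i < length Q + 2" using i by simp
  have "plus_word Q ! j \<noteq> 0" if "j < length Q" for j
    using subsetD[OF bin(2) nth_mem[OF that]] that by (auto simp: plus_word_def)
  then show ?thesis using iQ wst by (auto simp: nth_append nth_Cons')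
qed

theorem theorem2p18:
  shows "(\<forall>w. is_binary_dyck w \<longrightarrow>
            (\<exists>!p. is_partition p \<and> dyck_class w \<in> TAIL p))
       \<and> (\<forall>w. is_ternary_dyck w \<and> \<not> is_reduced w \<longrightarrow>
            (\<exists>!p. is_partition p \<and> dyck_class w \<in> TAIL p))
       \<and> (\<forall>w. is_ternary_dyck w \<and> is_reduced w \<and> 2 \<in> set w \<longrightarrow>
            ((\<exists>p. is_partition p \<and> dyck_class w \<in> TAIL p)
               \<longleftrightarrow> (\<forall>i < last_two w. w ! i = 0 \<longleftrightarrow> i = 0))
          \<and> (\<forall>p q. is_partition p \<and> dyck_class w \<in> TAIL p
                 \<and> is_partition q \<and> dyck_class w \<in> TAIL q \<longrightarrow> p = q))"
proof -
  have ex1: "\<exists>!p. is_partition p \<and> dyck_class w \<in> TAIL p"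
    if "\<exists>p. is_partition p \<and> dyck_class w \<in> TAIL p" for w
    using that TAIL_unique by blast
  show ?thesis
  proof (intro conjI allI impI)
    fix w assume w: "is_ternary_dyck w \<and> is_reduced w \<and> 2 \<in> set w"
    then show "(\<exists>p. is_partition p \<and> dyck_class w \<in> TAIL p)
        \<longleftrightarrow> (\<forall>i < last_two w. w ! i = 0 \<longleftrightarrow> i = 0)"
      using reduced_ternary_in_TAIL TAIL_imp_zeros_before_last_two by blast
  next
    fix w p q
    assume "is_partition p \<and> dyck_class w \<in> TAIL p \<and> is_partition q \<and> dyck_class w \<in> TAIL q"
    then show "p = q" using TAIL_unique by blast
  qed (use ex1 binary_in_TAIL nonreduced_ternary_in_TAIL in blast)+
qed

end
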